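(* Let $n$ be a positive integer and let $\mathcal A(n)$ be any family of partitions of $n$ of type $\mathcal P$. For $r=0,1,\dots,5$, let $T_r(n)$ denote the total number of parts congruent to $r\pmod 6$ occurring in all objects of $\mathcal A(n)$, counted with multiplicity. Then $$ S_{\mathcal P}(n)\equiv 0\pmod 3 \quad\text{if and only if}\quad T_1(n)+T_2(n)\equiv T_4(n)+T_5(n)\pmod 3. $$
   Context: A "type" $\mathcal P$ of partitions is an arbitrary class of partitions (for example ordinary partitions, partitions into distinct parts, overpartitions, coloured partitions); each partition $\lambda$ of $n$ of type $\mathcal P$ has a finite multiset of positive integer parts with sum $n$. $\mathcal A(n)$ is a finite family of partitions of $n$ of type $\mathcal P$. For $\lambda\in\mathcal A(n)$, $\omega(\lambda)$ is the sum of the odd parts of $\lambda$ minus the sum of the even parts of $\lambda$ (with multiplicity), and $S_{\mathcal P}(n)=\sum_{\lambda\in\mathcal A(n)}\omega(\lambda)$. *)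

theory Defs
  imports "HOL-Library.Multiset" "HOL-Number_Theory.Cong"
begin

text \<open>
  A type of partitions is a class of objects, given by a carrier \<open>P\<close> in an arbitrary HOL type,
  together with a map \<open>parts\<close> assigning to each object its finite multiset of positive parts. The
  map need not be injective, so decorated objects such as overpartitions or coloured partitions,
  which are not determined by their part sizes, are covered.
\<close>

definition partition_type :: "'a set \<Rightarrow> ('a \<Rightarrow> nat multiset) \<Rightarrow> bool" where
  "partition_type P parts \<longleftrightarrow> (\<forall>l\<in>P. \<forall>k. k \<in># parts l \<longrightarrow> k > 0)"

definition partitions_of :: "'a set \<Rightarrow> ('a \<Rightarrow> nat multiset) \<Rightarrow> nat \<Rightarrow> 'a set" where
  "partitions_of P parts n = {l \<in> P. sum_mset (parts l) = n}"

definition omega :: "nat multiset \<Rightarrow> int" where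
  "omega M = (\<Sum>k\<in>#filter_mset odd M. int k) - (\<Sum>k\<in>#filter_mset even M. int k)"

definition S :: "('a \<Rightarrow> nat multiset) \<Rightarrow> (nat \<Rightarrow> 'a set) \<Rightarrow> nat \<Rightarrow> int" where
  "S parts A n = (\<Sum>l\<in>A n. omega (parts l))"

definition T :: "('a \<Rightarrow> nat multiset) \<Rightarrow> (nat \<Rightarrow> 'a set) \<Rightarrow> nat \<Rightarrow> nat \<Rightarrow> nat" where
  "T parts A r n = (\<Sum>l\<in>A n. size {#k \<in># parts l. [k = r] (mod 6)#})"

end

theory Submission
  imports Defs
begin

text \<open>
  Since \<open>3\<close> divides \<open>6\<close>, a part \<open>k\<close> contributes to \<open>\<omega>\<close>, modulo \<open>3\<close>, an amount
  depending only on \<open>k mod 6\<close>: the residues \<open>0, 1, 2, 3, 4, 5\<close> contribute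
  \<open>0, 1, -2, 3, -4, 5\<close>, that is \<open>0, 1, 1, 0, -1, -1\<close>.
\<close>

lemma omega_empty [simp]: "omega {#} = 0"
  by (simp add: omega_def)

lemma omega_add_mset [simp]:
  "omega (add_mset k M) = (if odd k then int k else - int k) + omega M"
  by (simp add: omega_def)

text \<open>Since \<open>6\<close> is even, the parity of \<open>k\<close>, hence its sign, is that
  of \<open>k mod 6\<close>; since \<open>3\<close> divides \<open>6\<close>, the value survives
  reduction as well. Six cases remain.\<close>

lemma signed_part_cong_mod_3:
  "[(if odd k then int k else - int k) =
    of_bool ([k = 1] (mod 6)) + of_bool ([k = 2] (mod 6))
    - of_bool ([k = 4] (mod 6)) - of_bool ([k = 5] (mod 6))] (mod 3)"
proof -
  \<comment> \<open>With \<open>k = 6 * q + r\<close> for a numeral \<open>r\<close>, each case is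
    linear arithmetic in \<open>q\<close> with constant moduli, within reach of
    \<open>presburger\<close>.\<close>
  define q where "q = k div 6"
  have k: "k = 6 * q + k mod 6"
    by (simp add: q_def)
  have "k mod 6 < 6"
    by simp
  then consider "k mod 6 = 0" | "k mod 6 = 1" | "k mod 6 = 2"
    | "k mod 6 = 3" | "k mod 6 = 4" | "k mod 6 = 5"
    by linarith
  then show ?thesis
  proof cases
    case 1
    then have "k = 6 * q" using k by simp
    then show ?thesis by (simp add: cong_def; presburger)
  next
    case 2
    then have "k = 6 * q + 1" using k by simp
    then show ?thesis by (simp add: cong_def; presburger)
  next
    case 3
    then have "k = 6 * q + 2" using k by simp
    then show ?thesis by (simp add: cong_def; presburger)
  next
    case 4
    then have "k = 6 * q + 3" using k by simp
    then show ?thesis by (simp add: cong_def; presburger)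
  next
    case 5
    then have "k = 6 * q + 4" using k by simp
    then show ?thesis by (simp add: cong_def; presburger)
  next
    case 6
    then have "k = 6 * q + 5" using k by simp
    then show ?thesis by (simp add: cong_def; presburger)
  qed
qed

lemma omega_cong_mod_3:
  "[omega M = int (size {#k \<in># M. [k = 1] (mod 6)#}) + int (size {#k \<in># M. [k = 2] (mod 6)#})
    - int (size {#k \<in># M. [k = 4] (mod 6)#}) - int (size {#k \<in># M. [k = 5] (mod 6)#})] (mod 3)"
proof (induction M)
  case empty
  show ?case by simp
next
  case (add k M)
  \<comment> \<open>Writing the increment as \<open>of_bool\<close> matches the form of
    \<open>signed_part_cong_mod_3\<close>, so that congruence and the induction hypothesis can be
    added without splitting on the residue of \<open>k\<close>.\<close>
  have size_filter_add: "int (size (filter_mset Q (add_mset k M)))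
      = of_bool (Q k) + int (size (filter_mset Q M))" for Q
    by simp
  show ?case
    unfolding omega_add_mset size_filter_add
    using cong_add[OF signed_part_cong_mod_3[of k] add.IH] by (simp only: algebra_simps)
qed

text \<open>Congruences add up over the family, and the sums of the four counts are the
  corresponding values of \<open>T\<close>.\<close>

lemma S_cong_mod_3:
  "[S parts A n = int (T parts A 1 n) + int (T parts A 2 n)
    - int (T parts A 4 n) - int (T parts A 5 n)] (mod 3)"
proof -
  have "[S parts A n = (\<Sum>l\<in>A n.
      int (size {#k \<in># parts l. [k = 1] (mod 6)#}) + int (size {#k \<in># parts l. [k = 2] (mod 6)#})
    - int (size {#k \<in># parts l. [k = 4] (mod 6)#}) - int (size {#k \<in># parts l. [k = 5] (mod 6)#}))]
    (mod 3)"
    unfolding S_def by (intro cong_sum omega_cong_mod_3)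
  then show ?thesis
    unfolding T_def by (simp only: sum.distrib sum_subtractf of_nat_sum)
qed

theorem theorem4p3:
  fixes P :: "'a set" and parts :: "'a \<Rightarrow> nat multiset"
    and A :: "nat \<Rightarrow> 'a set" and n :: nat
  assumes "partition_type P parts"
    and "n > 0"
    and "finite (A n)"
    and "A n \<subseteq> partitions_of P parts n"
  shows "[S parts A n = 0] (mod 3) \<longleftrightarrow>
    [T parts A 1 n + T parts A 2 n = T parts A 4 n + T parts A 5 n] (mod 3)"
proof -
  let ?t = "\<lambda>r. T parts A r n"
  have "[S parts A n = 0] (mod 3) \<longleftrightarrow>
      [int (?t 1) + int (?t 2) - int (?t 4) - int (?t 5) = 0] (mod 3)"
    using S_cong_mod_3 cong_trans cong_sym by blast
  \<comment> \<open>Moving the negative terms across leaves images of naturals on both sides; the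
    modulus is written \<open>int 3\<close> to fit \<open>cong_int_iff\<close>, which returns to
    \<open>nat\<close>.\<close>
  also have "\<dots> \<longleftrightarrow> [int (?t 1 + ?t 2) = int (?t 4 + ?t 5)] (mod int 3)"
    by (simp add: cong_iff_dvd_diff algebra_simps)
  also have "\<dots> \<longleftrightarrow> [?t 1 + ?t 2 = ?t 4 + ?t 5] (mod 3)"
    by (rule cong_int_iff)
  finally show ?thesis .
qed

end
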